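(* Let $(X,d)$ and $(Y,\varrho)$ be metric spaces. Consider a $c> 0$, non-empty sets $U \subset X$ and $V \subset Y$, a function $\gamma: X \to [0, \infty]$ being defined and not identically zero on $U$, and a mapping $g: X \to Y$ defined on the whole $X$. Assume that for each $y \in V$ there is a $\lambda = \lambda(y) \in (0,1)$ such that for each $u \in X$ satisfying $$0 < \varrho(g(u),y) \leq \varrho(g(x),y) - c\, d(u,x) \quad \mbox{and} \quad \varrho(g(x),y) < c\, \gamma(x)$$ for some $x \in U$, there is a point $u'\in X$ such that $$\varrho(g(u'),y) + c\,d(u,u') \leq \lambda\, \varrho(g(u),y).$$ Then $g$ has property $(\mathcal{O})$ on $U \times V$ for $c$ and $\gamma$.
   Context: $B_X(x,r)$, $B_Y(y,r)$ denote open balls and $\overline{C}$ the closure of $C$. The function $\gamma$ need only be defined on $U$. A single-valued mapping $g:X\to Y$ has property $(\mathcal{O})$ on $U\times V$ for $c$ and $\gamma$ provided that $B_Y(g(x),ct)\cap V\subset\overline{g(B_X(x,t))}$ for each $x\in U$ and each $t\in(0,\gamma(x))$. *)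

theory Defs
  imports "HOL-Analysis.Analysis"
begin

text \<open>
  Extended-valued functions \<open>\<gamma> : X \<rightarrow> [0, \<infinity>]\<close> are rendered as maps into \<^typ>\<open>ennreal\<close>; only their
  values on \<open>U\<close> are ever used. The radius \<open>t\<close> ranges over the finite reals in \<open>(0, \<gamma>(x))\<close>.
\<close>

definition property_O ::
  "('a::metric_space \<Rightarrow> 'b::metric_space) \<Rightarrow> 'a set \<Rightarrow> 'b set \<Rightarrow> real \<Rightarrow> ('a \<Rightarrow> ennreal) \<Rightarrow> bool"
where
  "property_O g U V c \<gamma> \<longleftrightarrow>
     (\<forall>x\<in>U. \<forall>t::real. 0 < t \<and> ennreal t < \<gamma> x \<longrightarrow>
        ball (g x) (c * t) \<inter> V \<subseteq> closure (g ` ball x t))"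

end

theory Submission
  imports Defs
begin

text \<open>
  Starting from \<open>x\<close>, each step contracts \<open>dist (g u) y\<close> by the factor \<open>lam\<close> while preserving the
  Ekeland-type inequality \<open>dist (g u) y + c * dist u x \<le> dist (g x) y\<close>. The latter keeps
  all iterates in \<open>ball x t\<close>, and their images converge to \<open>y\<close>; no completeness is needed since
  only the closure of the image is at stake.
\<close>

theorem proposition4p1:
  fixes g :: "'a::metric_space \<Rightarrow> 'b::metric_space"
    and U :: "'a set" and V :: "'b set"
    and c :: real and \<gamma> :: "'a \<Rightarrow> ennreal"
  assumes "c > 0"
    and "U \<noteq> {}" and "V \<noteq> {}"
    and "\<exists>x\<in>U. \<gamma> x \<noteq> 0"
    and "\<forall>y\<in>V. \<exists>lam::real. 0 < lam \<and> lam < 1 \<and>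
           (\<forall>u. (\<exists>x\<in>U. 0 < dist (g u) y \<and>
                        dist (g u) y \<le> dist (g x) y - c * dist u x \<and>
                        ennreal (dist (g x) y) < ennreal c * \<gamma> x)
                \<longrightarrow> (\<exists>u'. dist (g u') y + c * dist u u' \<le> lam * dist (g u) y))"
  shows "property_O g U V c \<gamma>"
  unfolding property_O_def
proof (intro ballI allI impI subsetI)
  fix x :: 'a and t :: real and y :: 'b
  assume x: "x \<in> U" and t: "0 < t \<and> ennreal t < \<gamma> x" and y: "y \<in> ball (g x) (c * t) \<inter> V"
  have yct: "dist (g x) y < c * t" and "y \<in> V"
    using y by auto
  \<comment> \<open>\<open>lam\<close> depends on \<open>y\<close> alone, so one contraction factor
    serves all iterates. The existential point of \<open>U\<close> is fixed to be the centre
    \<open>x\<close>.\<close>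
  obtain lam :: real where lam: "0 < lam" "lam < 1"
    and step: "\<And>u. 0 < dist (g u) y \<Longrightarrow> dist (g u) y \<le> dist (g x) y - c * dist u x \<Longrightarrow>
      ennreal (dist (g x) y) < ennreal c * \<gamma> x \<Longrightarrow>
      \<exists>u'. dist (g u') y + c * dist u u' \<le> lam * dist (g u) y"
    using assms(5) \<open>y \<in> V\<close> x by meson
  \<comment> \<open>\<open>\<gamma> x\<close> may be infinite, so the comparison passes through the
    finite radius \<open>t\<close> inside \<open>ennreal\<close>.\<close>
  have "ennreal (dist (g x) y) < ennreal (c * t)"
    using yct t assms(1) by (simp add: ennreal_less_iff)
  also have "\<dots> = ennreal c * ennreal t"
    using assms(1) t by (simp add: ennreal_mult)
  also have "\<dots> \<le> ennreal c * \<gamma> x"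
    using t by (intro mult_left_mono) auto
  finally have less: "ennreal (dist (g x) y) < ennreal c * \<gamma> x" .
  \<comment> \<open>The second conjunct is a premise of \<open>step\<close>, so each iterate
    qualifies for the next application.\<close>
  have approx: "\<exists>u. dist (g u) y \<le> lam ^ n * dist (g x) y \<and>
      dist (g u) y \<le> dist (g x) y - c * dist u x" for n
  proof (induction n)
    case 0
    show ?case by (intro exI[of _ x]) simp
  next
    case (Suc n)
    then obtain u where u: "dist (g u) y \<le> lam ^ n * dist (g x) y"
      "dist (g u) y \<le> dist (g x) y - c * dist u x"
      by blast
    show ?case
    proof (cases "dist (g u) y = 0")
      \<comment> \<open>Here \<open>step\<close> does not apply, but \<open>u\<close> already maps
        to \<open>y\<close> and meets every later bound.\<close>
      case True
      then show ?thesis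
        using u(2) lam(1) by (intro exI[of _ u]) simp
    next
      case False
      then obtain u' where u': "dist (g u') y + c * dist u u' \<le> lam * dist (g u) y"
        using step[OF _ u(2) less] by auto
      have "dist (g u') y \<le> lam * dist (g u) y"
        using u' assms(1) by (smt (verit) mult_nonneg_nonneg zero_le_dist)
      also have "\<dots> \<le> lam ^ Suc n * dist (g x) y"
        using u(1) lam(1) by simp
      finally have contr: "dist (g u') y \<le> lam ^ Suc n * dist (g x) y" .
      \<comment> \<open>With the factor \<open>lam\<close> weakened to 1, \<open>u'\<close> bounds
        \<open>c * dist u u'\<close> by the decrease of the distance to \<open>y\<close>; these
        decreases telescope along the iterates.\<close>
      have "lam * dist (g u) y \<le> dist (g u) y"
        using lam by (simp add: mult_left_le_one_le)
      moreover have "c * dist u' x \<le> c * dist u u' + c * dist u x"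
        using mult_left_mono[OF dist_triangle3[of u' x u], of c] assms(1)
        by (simp add: distrib_left)
      ultimately have "dist (g u') y \<le> dist (g x) y - c * dist u' x"
        using u' u(2) by linarith
      with contr show ?thesis by blast
    qed
  qed
  show "y \<in> closure (g ` ball x t)"
    unfolding closure_approachable
  proof (intro allI impI)
    fix e :: real
    assume "0 < e"
    have "(\<lambda>n. lam ^ n * dist (g x) y) \<longlonglongrightarrow> 0"
      using lam by (intro tendsto_mult_left_zero LIMSEQ_power_zero) simp
    then obtain n where n: "lam ^ n * dist (g x) y < e"
      using order_tendstoD(2)[OF _ \<open>0 < e\<close>] eventually_happens' sequentially_bot by blast
    obtain u where u: "dist (g u) y \<le> lam ^ n * dist (g x) y"
      "dist (g u) y \<le> dist (g x) y - c * dist u x"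
      using approx by blast
    \<comment> \<open>Dropping \<open>dist (g u) y \<ge> 0\<close> leaves
      \<open>c * dist u x \<le> dist (g x) y\<close>; strictness comes from the open ball around
      \<open>g x\<close>.\<close>
    have "c * dist u x < c * t"
      using u(2) yct zero_le_dist[of "g u" y] by linarith
    then have "u \<in> ball x t"
      using assms(1) by (simp add: dist_commute)
    then show "\<exists>z\<in>g ` ball x t. dist z y < e"
      using u(1) n by force
  qed
qed

end
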